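(* Let $0<\kappa<1$ and let $\mathrm{rn}_2:\mathbb{R}\to\mathbb{R}$ be the function $\sin\tfrac12\psi$ defined in the context (for the modulus $\kappa$). Then $\mathrm{rn}_2$ satisfies the initial condition $\mathrm{rn}_2(0)=0$ and the differential equation $$(\mathrm{rn}_2')^2=\mathrm{rn}_2^4-\mathrm{rn}_2^2+\tfrac14\kappa^2$$ on $\mathbb{R}$.
   Context: $F(a,b;c;z)={}_2F_1(a,b;c;z)$ is the Gauss hypergeometric function. Fix the modulus $\kappa\in(0,1)$. The map $\mathbb{R}\to\mathbb{R}$, $T\mapsto\int_0^T F(\tfrac14,\tfrac34;\tfrac12;\kappa^2\sin^2 t)\,dt$, is an odd strictly increasing bijection; $\phi:\mathbb{R}\to\mathbb{R}$ denotes its inverse. Put $\psi=\arcsin(\kappa\sin\phi):\mathbb{R}\to(-\tfrac{\pi}{2},\tfrac{\pi}{2})$ and $\mathrm{rn}_2=\sin\tfrac12\psi:\mathbb{R}\to\mathbb{R}$. *)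

theory Defs
  imports "HOL-Analysis.Analysis"
begin

text \<open>
  The Gauss hypergeometric function on its disc of convergence. Only arguments
  $0 \le z < 1$ are used below; outside the unit disc the value is unspecified (there is no
  analytic continuation).
\<close>

definition hypergeo_2F1 :: "real \<Rightarrow> real \<Rightarrow> real \<Rightarrow> real \<Rightarrow> real" where
  "hypergeo_2F1 a b c z = eval_fps (fps_hypergeo [a, b] [c] 1) z"

lemma hypergeo_2F1_series:
  "hypergeo_2F1 a b c z =
     (\<Sum>n. pochhammer a n * pochhammer b n / (pochhammer c n * fact n) * z ^ n)"
  by (simp add: hypergeo_2F1_def eval_fps_def mult.commute)

text \<open>The interval integral is oriented, so negative \<open>T\<close> carries the usual sign.\<close>

definition Phi_integral :: "real \<Rightarrow> real \<Rightarrow> real" where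
  "Phi_integral \<kappa> T = (LBINT t=0..T. hypergeo_2F1 (1/4) (3/4) (1/2) (\<kappa>\<^sup>2 * (sin t)\<^sup>2))"

text \<open>
  For \<open>0 < \<kappa> < 1\<close> the map \<open>Phi_integral \<kappa>\<close> is a bijection of the reals, so \<open>inv\<close> is its
  two-sided inverse.
\<close>

definition phi :: "real \<Rightarrow> real \<Rightarrow> real" where
  "phi \<kappa> = inv (Phi_integral \<kappa>)"

definition psi :: "real \<Rightarrow> real \<Rightarrow> real" where
  "psi \<kappa> u = arcsin (\<kappa> * sin (phi \<kappa> u))"

definition rn2 :: "real \<Rightarrow> real \<Rightarrow> real" where
  "rn2 \<kappa> u = sin (psi \<kappa> u / 2)"

end

theory Submission
  imports Defs
begin

text \<open>
  The hypergeometric integrand is an algebraic function in disguise. Its series collects the even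
  terms of the binomial series, so \<open>F(a, a + 1/2; 1/2; z\<^sup>2)\<close> is the even part of
  \<open>(1 + z) powr (- 2 * a)\<close>. For \<open>a = 1/4\<close> and \<open>z = sin \<psi>\<close> the square roots resolve through
  \<open>1 \<plusminus> sin \<psi> = (cos (\<psi>/2) \<plusminus> sin (\<psi>/2))\<^sup>2\<close>, and the integrand becomes
  \<open>cos (\<psi>/2) / cos \<psi>\<close>, where \<open>sin \<psi> = \<kappa> * sin t\<close>.

  This quotient is continuous and at least 1, so the integral is a bijection of the reals with a
  differentiable inverse, \<open>\<phi>' = cos \<psi> / cos (\<psi>/2)\<close>. Differentiating \<open>sin \<psi> = \<kappa> * sin \<phi>\<close> gives
  \<open>cos \<psi> * \<psi>' = \<kappa> * cos \<phi> * \<phi>'\<close>, hence \<open>\<psi>' = \<kappa> * cos \<phi> / cos (\<psi>/2)\<close>. The factor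
  \<open>cos (\<psi>/2)\<close> is exactly what the chain rule for \<open>s = sin (\<psi>/2)\<close> produces, and it cancels:
  \<open>s' = \<kappa> * cos \<phi> / 2\<close>. The differential equation is then the Pythagorean identity, since
  \<open>4 * s'\<^sup>2 = \<kappa>\<^sup>2 - sin\<^sup>2 \<psi>\<close> and \<open>sin\<^sup>2 \<psi> = 4 * s\<^sup>2 * (1 - s\<^sup>2)\<close>.
\<close>

text \<open>
  Both \<open>pochhammer (2 * a) (2 * n)\<close> and \<open>fact (2 * n) = pochhammer 1 (2 * n)\<close> split by the
  duplication formula, and the powers of 2 cancel.
\<close>

lemma gbinomial_even_eq_pochhammer:
  fixes a :: real
  shows "(- 2 * a) gchoose (2 * n) =
    pochhammer a n * pochhammer (a + 1/2) n / (pochhammer (1/2) n * fact n)"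
proof -
  have "fact (2 * n) = pochhammer (2 * (1/2) :: real) (2 * n)"
    by (simp add: pochhammer_fact)
  also have "\<dots> = 2 ^ (2 * n) * pochhammer (1/2) n * pochhammer 1 n"
    by (subst pochhammer_double) simp
  finally have "fact (2 * n) = 2 ^ (2 * n) * pochhammer (1/2 :: real) n * fact n"
    by (simp add: pochhammer_fact)
  moreover have "(- 2 * a) gchoose (2 * n) = pochhammer (2 * a) (2 * n) / fact (2 * n)"
    by (simp add: gbinomial_pochhammer)
  ultimately show ?thesis
    by (simp add: pochhammer_double)
qed

text \<open>
  Averaging the binomial series at \<open>z\<close> and \<open>- z\<close> removes the odd terms and leaves the
  hypergeometric series in \<open>z\<^sup>2\<close>.
\<close>

lemma hypergeo_2F1_square:
  fixes a z :: real
  assumes "\<bar>z\<bar> < 1"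
  shows "hypergeo_2F1 a (a + 1/2) (1/2) (z\<^sup>2) =
    ((1 + z) powr (- 2 * a) + (1 - z) powr (- 2 * a)) / 2"
proof -
  define g where "g n = (- 2 * a) gchoose n" for n
  have "(\<lambda>n. g n * z ^ n) sums (1 + z) powr (- 2 * a)"
    using gen_binomial_real[of z "- 2 * a"] assms by (simp add: g_def)
  moreover have "(\<lambda>n. g n * (- z) ^ n) sums (1 - z) powr (- 2 * a)"
    using gen_binomial_real[of "- z" "- 2 * a"] assms by (simp add: g_def)
  ultimately have "(\<lambda>n. (g n * z ^ n + g n * (- z) ^ n) / 2) sums
      (((1 + z) powr (- 2 * a) + (1 - z) powr (- 2 * a)) / 2)"
    by (intro sums_divide sums_add)
  moreover have "(g n * z ^ n + g n * (- z) ^ n) / 2 = 0" if "n \<notin> range ((*) 2)" for n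
  proof -
    have "odd n"
      using that by (auto elim: evenE)
    then show ?thesis
      by simp
  qed
  moreover have "strict_mono ((*) (2 :: nat))"
    by (simp add: strict_mono_def)
  ultimately have "(\<lambda>n. (g (2 * n) * z ^ (2 * n) + g (2 * n) * (- z) ^ (2 * n)) / 2) sums
      (((1 + z) powr (- 2 * a) + (1 - z) powr (- 2 * a)) / 2)"
    by (subst sums_mono_reindex[of "(*) 2"])
  moreover have "(g (2 * n) * z ^ (2 * n) + g (2 * n) * (- z) ^ (2 * n)) / 2 =
      pochhammer a n * pochhammer (a + 1/2) n / (pochhammer (1/2) n * fact n) * (z\<^sup>2) ^ n" for n
    unfolding g_def gbinomial_even_eq_pochhammer by (simp add: power_mult) (simp add: mult_ac)
  ultimately show ?thesis
    unfolding hypergeo_2F1_series by (simp add: sums_iff)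
qed

text \<open>
  The range of \<open>\<psi>\<close> makes \<open>cos (\<psi>/2) \<plusminus> sin (\<psi>/2)\<close> positive, so these are the square roots of
  \<open>1 \<plusminus> sin \<psi>\<close>, and their product is \<open>cos \<psi>\<close>.
\<close>

lemma hypergeo_2F1_sin:
  fixes \<psi> :: real
  assumes "\<bar>\<psi>\<bar> < pi / 2"
  shows "hypergeo_2F1 (1/4) (3/4) (1/2) ((sin \<psi>)\<^sup>2) = cos (\<psi> / 2) / cos \<psi>"
proof -
  define c s where "c = cos (\<psi> / 2)" and "s = sin (\<psi> / 2)"
  have cos: "cos \<psi> = c\<^sup>2 - s\<^sup>2" and sin: "sin \<psi> = 2 * s * c" and one: "s\<^sup>2 + c\<^sup>2 = 1"
    using cos_double[of "\<psi> / 2"] sin_double[of "\<psi> / 2"] by (simp_all add: c_def s_def)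
  have "c > 0" and "cos \<psi> > 0"
    unfolding c_def using assms by (auto intro!: cos_gt_zero_pi)
  have "\<bar>s\<bar> < c"
    using \<open>cos \<psi> > 0\<close> \<open>c > 0\<close> cos power2_less_imp_less[of "\<bar>s\<bar>" c] by simp
  then have pos: "c + s > 0" "c - s > 0"
    by auto
  have plus: "(1 + sin \<psi>) powr (- (1/2)) = 1 / (c + s)"
  proof -
    have "1 + sin \<psi> = (c + s)\<^sup>2"
      using one sin by (simp add: power2_eq_square algebra_simps)
    then show ?thesis
      using pos by (simp only: powr_minus powr_half_sqrt zero_le_power2 real_sqrt_abs)
        (simp add: inverse_eq_divide)
  qed
  have minus: "(1 - sin \<psi>) powr (- (1/2)) = 1 / (c - s)"
  proof -
    have "1 - sin \<psi> = (c - s)\<^sup>2"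
      using one sin by (simp add: power2_eq_square algebra_simps)
    then show ?thesis
      using pos by (simp only: powr_minus powr_half_sqrt zero_le_power2 real_sqrt_abs)
        (simp add: inverse_eq_divide)
  qed
  have "\<bar>sin \<psi>\<bar> < 1"
    using \<open>cos \<psi> > 0\<close> by (simp add: abs_square_less_1[symmetric] sin_squared_eq)
  then have "hypergeo_2F1 (1/4) (3/4) (1/2) ((sin \<psi>)\<^sup>2) = (1 / (c + s) + 1 / (c - s)) / 2"
    using hypergeo_2F1_square[of "sin \<psi>" "1/4"] plus minus by simp
  also have "\<dots> = c / (c\<^sup>2 - s\<^sup>2)"
  proof -
    have "c\<^sup>2 - s\<^sup>2 = (c + s) * (c - s)"
      by (simp add: power2_eq_square algebra_simps)
    then show ?thesis
      using pos by (simp add: divide_simps)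
  qed
  finally show ?thesis
    by (simp add: cos c_def)
qed

text \<open>
  The derivative bound lets \<open>f\<close> grow at least as fast as the identity. This gives injectivity,
  and surjectivity through the intermediate value theorem.
\<close>

lemma inverse_of_expanding_function:
  fixes f f' :: "real \<Rightarrow> real"
  assumes deriv: "\<And>x. (f has_real_derivative f' x) (at x)"
    and ge1: "\<And>x. f' x \<ge> 1"
  shows "bij f" and "(inv f has_real_derivative 1 / f' (inv f y)) (at y)"
proof -
  have grow: "y - x \<le> f y - f x" if "x \<le> y" for x y
  proof -
    have "f x - x \<le> f y - y"
    proof (rule DERIV_nonneg_imp_nondecreasing[OF that])
      fix w
      have "((\<lambda>v. f v - v) has_real_derivative f' w - 1) (at w)"
        by (intro DERIV_diff deriv DERIV_ident)
      then show "\<exists>d. ((\<lambda>v. f v - v) has_real_derivative d) (at w) \<and> d \<ge> 0"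
        using ge1[of w] by force
    qed
    then show ?thesis
      by simp
  qed
  have "inj f"
  proof (rule injI)
    fix x y assume "f x = f y"
    then show "x = y"
      using grow[of x y] grow[of y x] by linarith
  qed
  have cont: "continuous_on A f" for A
    using deriv by (meson DERIV_isCont continuous_at_imp_continuous_on)
  have "\<exists>x. f x = y" for y
  proof -
    \<comment> \<open>Expansion carries the interval of radius \<open>r\<close> about 0 over the one of radius \<open>r\<close> about \<open>f 0\<close>,
      and \<open>y\<close> lies in the latter.\<close>
    define r where "r = \<bar>y - f 0\<bar>"
    have "f (- r) \<le> y" "y \<le> f r" "- r \<le> r"
      using grow[of "- r" 0] grow[of 0 r] by (auto simp: r_def)
    then show ?thesis
      using IVT'[of f "- r" y r] cont by blast
  qed
  then show "bij f"
    using \<open>inj f\<close> by (metis bijI surjI)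
  then have "f (inv f y) = y" "\<And>x. inv f (f x) = x"
    by (simp_all add: bij_is_surj surj_f_inv_f bij_is_inj)
  then show "(inv f has_real_derivative 1 / f' (inv f y)) (at y)"
    using has_derivative_inverse_strong[of UNIV "inv f y" f "inv f" "(*) (f' (inv f y))"
        "(*) (1 / f' (inv f y))"] deriv[of "inv f y"] ge1[of "inv f y"] cont
    by (auto simp: has_field_derivative_def fun_eq_iff)
qed

lemma abs_modulus_sin_less_1:
  fixes \<kappa> :: real
  assumes "\<bar>\<kappa>\<bar> < 1"
  shows "\<bar>\<kappa> * sin t\<bar> < 1"
proof -
  have "\<bar>\<kappa>\<bar> * \<bar>sin t\<bar> \<le> \<bar>\<kappa>\<bar>"
    by (rule mult_left_le) auto
  then show ?thesis
    using assms by (simp add: abs_mult)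
qed

lemma abs_arcsin_modulus_sin_less_pi_half:
  fixes \<kappa> :: real
  assumes "\<bar>\<kappa>\<bar> < 1"
  shows "\<bar>arcsin (\<kappa> * sin t)\<bar> < pi / 2"
proof -
  have "- 1 < \<kappa> * sin t" "\<kappa> * sin t < 1"
    using abs_modulus_sin_less_1[OF assms, of t] by linarith+
  then show ?thesis
    using arcsin_lt_bounded[of "\<kappa> * sin t"] by linarith
qed

text \<open>
  The lower bound comes from \<open>cos \<psi> \<le> cos\<^sup>2 (\<psi>/2) \<le> cos (\<psi>/2)\<close>; it is what makes the integral
  invertible on all of the real line.
\<close>

lemma Phi_integral_has_derivative:
  assumes "\<bar>\<kappa>\<bar> < 1"
  defines "\<psi> \<equiv> \<lambda>t. arcsin (\<kappa> * sin t)"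
  shows "(Phi_integral \<kappa> has_real_derivative cos (\<psi> t / 2) / cos (\<psi> t)) (at t)"
    and "cos (\<psi> t / 2) / cos (\<psi> t) \<ge> 1"
proof -
  note arg = abs_modulus_sin_less_1[OF assms(1)]
  have bounds: "\<bar>\<psi> t\<bar> < pi / 2" for t
    unfolding \<psi>_def by (rule abs_arcsin_modulus_sin_less_pi_half[OF assms(1)])
  have cos_pos: "cos (\<psi> t) > 0" for t
    using bounds[of t] by (intro cos_gt_zero_pi) auto
  have "- 1 \<le> \<kappa> * sin t \<and> \<kappa> * sin t \<le> 1" for t
    using arg[of t] by linarith
  then have "continuous_on UNIV \<psi>"
    unfolding \<psi>_def by (intro continuous_on_arcsin continuous_intros ballI)
  then have "continuous_on UNIV (\<lambda>t. cos (\<psi> t / 2) / cos (\<psi> t))"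
    by (intro continuous_intros ballI) (use cos_pos in \<open>auto simp: less_imp_neq[symmetric]\<close>)
  moreover have integrand:
    "hypergeo_2F1 (1/4) (3/4) (1/2) (\<kappa>\<^sup>2 * (sin t)\<^sup>2) = cos (\<psi> t / 2) / cos (\<psi> t)" for t
    using hypergeo_2F1_sin[OF bounds[of t]] arg[of t]
    by (simp add: \<psi>_def power_mult_distrib abs_less_iff)
  ultimately have "((\<lambda>T. LBINT t=0..T. cos (\<psi> t / 2) / cos (\<psi> t)) has_vector_derivative
      cos (\<psi> t / 2) / cos (\<psi> t)) (at t within {- \<bar>t\<bar> - 1..\<bar>t\<bar> + 1})"
    unfolding zero_ereal_def
    by (intro interval_integral_FTC2) (auto intro: continuous_on_subset)
  then show "(Phi_integral \<kappa> has_real_derivative cos (\<psi> t / 2) / cos (\<psi> t)) (at t)"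
    by (simp add: Phi_integral_def[abs_def] integrand at_within_Icc_at
        has_real_derivative_iff_has_vector_derivative)
  show "cos (\<psi> t / 2) / cos (\<psi> t) \<ge> 1"
  proof -
    have "cos (\<psi> t) \<le> (cos (\<psi> t / 2))\<^sup>2"
      using cos_double[of "\<psi> t / 2"] by simp
    also have "\<dots> \<le> cos (\<psi> t / 2)"
      using bounds[of t] cos_gt_zero_pi[of "\<psi> t / 2"] cos_le_one
      by (simp add: power2_eq_square mult_left_le)
    finally show ?thesis
      using cos_pos by simp
  qed
qed

text \<open>
  The integrand equals \<open>cos (\<psi>/2) / cos \<psi>\<close>: its denominator cancels against the derivative of
  \<open>arcsin\<close>, and its numerator against the outer derivative of \<open>sin (\<psi>/2)\<close>.
\<close>

lemma rn2_has_derivative: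
  assumes "\<bar>\<kappa>\<bar> < 1"
  shows "(rn2 \<kappa> has_real_derivative \<kappa> * cos (phi \<kappa> u) / 2) (at u)"
proof -
  define t where "t = phi \<kappa> u"
  note Phi = Phi_integral_has_derivative[OF assms]
  have psi: "psi \<kappa> u = arcsin (\<kappa> * sin t)"
    by (simp add: psi_def t_def)
  have arg: "-1 < \<kappa> * sin t" "\<kappa> * sin t < 1"
    using abs_modulus_sin_less_1[OF assms, of t] by auto
  have cos: "cos (psi \<kappa> u) > 0" "cos (psi \<kappa> u / 2) > 0"
    using abs_arcsin_modulus_sin_less_pi_half[OF assms, of t] unfolding psi
    by (auto intro!: cos_gt_zero_pi)
  have sqrt: "sqrt (1 - (\<kappa> * sin t)\<^sup>2) = cos (psi \<kappa> u)"
    using arg by (simp add: psi cos_arcsin)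
  have phi: "(phi \<kappa> has_real_derivative cos (psi \<kappa> u) / cos (psi \<kappa> u / 2)) (at u)"
    using inverse_of_expanding_function(2)[OF Phi(1) Phi(2), of u]
    by (simp add: phi_def[symmetric] psi_def)
  have "((\<lambda>x. \<kappa> * sin (phi \<kappa> x)) has_real_derivative
      \<kappa> * (cos t * (cos (psi \<kappa> u) / cos (psi \<kappa> u / 2)))) (at u)"
    using phi by (auto intro!: derivative_eq_intros simp: t_def)
  then have "(psi \<kappa> has_real_derivative
      inverse (cos (psi \<kappa> u)) * (\<kappa> * (cos t * (cos (psi \<kappa> u) / cos (psi \<kappa> u / 2))))) (at u)"
    unfolding psi_def[abs_def]
    by (rule DERIV_chain2[where f = arcsin, rotated])
      (use DERIV_arcsin[OF arg] sqrt in \<open>simp add: t_def psi_def\<close>)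
  then have "(psi \<kappa> has_real_derivative \<kappa> * cos t / cos (psi \<kappa> u / 2)) (at u)"
    using cos by (simp add: field_simps)
  then have "(rn2 \<kappa> has_real_derivative
      cos (psi \<kappa> u / 2) * (\<kappa> * cos t / cos (psi \<kappa> u / 2) / 2)) (at u)"
    unfolding rn2_def[abs_def] by (auto intro!: derivative_eq_intros)
  then show ?thesis
    using cos by (simp add: t_def)
qed

theorem theorem3:
  fixes \<kappa> :: real
  assumes "0 < \<kappa>" and "\<kappa> < 1"
  shows "rn2 \<kappa> 0 = 0 \<and>
    (\<forall>u::real. rn2 \<kappa> differentiable (at u) \<and>
       (deriv (rn2 \<kappa>) u)\<^sup>2 = (rn2 \<kappa> u) ^ 4 - (rn2 \<kappa> u)\<^sup>2 + \<kappa>\<^sup>2 / 4)"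
proof (intro conjI allI)
  have k: "\<bar>\<kappa>\<bar> < 1"
    using assms by simp
  note Phi = Phi_integral_has_derivative[OF k]
  have "inj (Phi_integral \<kappa>)"
    using inverse_of_expanding_function(1)[OF Phi(1) Phi(2)] by (rule bij_is_inj)
  moreover have "Phi_integral \<kappa> 0 = 0"
    by (simp add: Phi_integral_def zero_ereal_def)
  ultimately have "phi \<kappa> 0 = 0"
    unfolding phi_def by (metis inv_f_f)
  then show "rn2 \<kappa> 0 = 0"
    by (simp add: rn2_def psi_def)
  fix u
  note rn2' = rn2_has_derivative[OF k, of u]
  show "rn2 \<kappa> differentiable (at u)"
    using rn2' unfolding real_differentiable_def by blast
  define s where "s = rn2 \<kappa> u"
  have "\<kappa> * sin (phi \<kappa> u) = sin (psi \<kappa> u)"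
    using abs_modulus_sin_less_1[OF k, of "phi \<kappa> u"] by (simp add: psi_def abs_less_iff)
  then have "(\<kappa> * sin (phi \<kappa> u))\<^sup>2 = 4 * s\<^sup>2 * (cos (psi \<kappa> u / 2))\<^sup>2"
    using sin_double[of "psi \<kappa> u / 2"] by (simp add: s_def rn2_def power_mult_distrib)
  also have "\<dots> = 4 * s\<^sup>2 * (1 - s\<^sup>2)"
    by (simp add: s_def rn2_def cos_squared_eq)
  finally have sin: "\<kappa>\<^sup>2 * (sin (phi \<kappa> u))\<^sup>2 = 4 * s\<^sup>2 * (1 - s\<^sup>2)"
    by (simp add: power_mult_distrib)
  have "(deriv (rn2 \<kappa>) u)\<^sup>2 = \<kappa>\<^sup>2 * (1 - (sin (phi \<kappa> u))\<^sup>2) / 4"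
    unfolding DERIV_imp_deriv[OF rn2'] by (simp add: power_mult_distrib power_divide cos_squared_eq)
  also have "\<dots> = s ^ 4 - s\<^sup>2 + \<kappa>\<^sup>2 / 4"
    using sin by (simp add: field_simps power2_eq_square power4_eq_xxxx)
  finally show "(deriv (rn2 \<kappa>) u)\<^sup>2 = (rn2 \<kappa> u) ^ 4 - (rn2 \<kappa> u)\<^sup>2 + \<kappa>\<^sup>2 / 4"
    by (simp add: s_def)
qed

end
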